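(* Let $p\ge 2$ be a real number. Then for all $x\in(0,\pi_p/2)$, $$e^{\alpha x^p}<\frac{\sin_p x}{x}<e^{\beta x^p}$$ with the best possible constants $\alpha=\dfrac{2^p\ln(2/\pi_p)}{\pi_p^p}$ and $\beta=-\dfrac{1}{p(p+1)}$. Here "best possible" means that $\alpha$ cannot be replaced by any larger constant, and $\beta$ cannot be replaced by any smaller constant, so that the respective inequality still holds for all $x\in(0,\pi_p/2)$.
   Context: For real $1<p<\infty$, define $\arcsin_p:[0,1]\to\mathbb{R}$ by $\arcsin_p(x)=\int_0^x\frac{dt}{(1-t^p)^{1/p}}$, and let $\pi_p=2\arcsin_p(1)=\frac{2\pi}{p\sin(\pi/p)}$. The generalized sine function $\sin_p:[0,\pi_p/2]\to[0,1]$ is the inverse of $\arcsin_p$; it is strictly increasing with $\sin_p 0=0$ and $\sin_p(\pi_p/2)=1$. *)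

theory Defs
  imports "HOL-Analysis.Analysis"
begin

text \<open>The integral is a Henstock-Kurzweil integral, so the (integrable) singularity of the
  integrand at \<open>t = 1\<close> needs no separate limit. The argument \<open>x\<close> is meant to range over
  \<open>[0, 1]\<close>, and the parameter \<open>p\<close> over \<open>(1, \<infinity>)\<close>.\<close>

definition arcsin_p :: "real \<Rightarrow> real \<Rightarrow> real" where
  "arcsin_p p x = integral {0..x} (\<lambda>t. 1 / (1 - t powr p) powr (1 / p))"

definition pi_p :: "real \<Rightarrow> real" where
  "pi_p p = 2 * arcsin_p p 1"

text \<open>Meaningful on \<open>[0, pi_p p / 2]\<close>, the image of \<open>[0, 1]\<close> under \<open>arcsin_p p\<close>.\<close>

definition sin_p :: "real \<Rightarrow> real \<Rightarrow> real" where
  "sin_p p = inv_into {0..1} (arcsin_p p)"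

end

theory Submission
  imports Defs
begin

text \<open>
  Put \<open>x = arcsin_p s\<close> with \<open>0 < s < 1\<close>. Then \<open>sin_p x / x = exp (- L x\<^sup>p)\<close>, where
  \<open>L = ln (arcsin_p s / s) / (arcsin_p s)\<^sup>p\<close> is \<open>log_ratio p s\<close>. Everything follows once \<open>L\<close> is known to be
  strictly increasing in \<open>s\<close> (\<open>log_ratio_strict_mono\<close>), with limit \<open>1 / (p (p + 1)) = - \<beta>\<close> at \<open>0\<close>
  (\<open>log_ratio_tendsto\<close>) and with the value \<open>- \<alpha>\<close> at \<open>s = 1\<close>, attained continuously: the range of \<open>L\<close> is then
  the open interval from \<open>- \<beta>\<close> to \<open>- \<alpha>\<close>.

  For the monotonicity let \<open>t = s\<^sup>p\<close> and \<open>h = 1 - x cos_p x / sin_p x\<close>. Differentiation gives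
  \<open>s L' = (h - p ln (x / s)) / ((1 - h) x\<^sup>p)\<close>, and then
  \<open>s (h - p ln (x / s))' = \<Phi> / ((1 - t) (1 - h))\<close> with
  \<open>\<Phi> = t (1 + (p - 1) h) - h (1 + p - h)\<close>. As \<open>h - p ln (x / s)\<close> vanishes at \<open>0\<close>, it suffices that
  \<open>\<Phi> > 0\<close> (\<open>defect_below_barrier\<close>). The function \<open>h\<close> obeys the linear equation
  \<open>s (1 - t) h' = t - h\<close>, so \<open>\<Phi>'\<close> is again an algebraic expression in \<open>t\<close> and \<open>h\<close>; for \<open>p \<ge> 2\<close> it is
  positive wherever \<open>\<Phi> \<le> 0\<close> (\<open>barrier_direction\<close>). Since \<open>\<Phi>\<close> also starts at \<open>0\<close>, it can never become
  nonpositive.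
\<close>

section \<open>Functions of the sine value\<close>

text \<open>The generalized cosine \<open>sin_p' = (1 - sin_p\<^sup>p)\<^sup>1\<^sup>/\<^sup>p\<close>, written as a function of the sine.\<close>
definition cos_of_sin :: "real \<Rightarrow> real \<Rightarrow> real" where
  "cos_of_sin p s = (1 - s powr p) powr (1 / p)"

text \<open>The quantity \<open>h = 1 - x cos_p x / sin_p x\<close> at \<open>x = arcsin_p s\<close>. It is the natural unknown here:
  the logarithmic derivatives of \<open>arcsin_p\<close> are rational in \<open>h\<close>, and \<open>h\<close> itself solves a
  first-order linear differential equation with coefficients rational in \<open>t = s\<^sup>p\<close>.\<close>
definition defect :: "real \<Rightarrow> real \<Rightarrow> real" where
  "defect p s = 1 - arcsin_p p s * cos_of_sin p s / s"

text \<open>Equals \<open>- ln (sin_p x / x) / x\<^sup>p\<close> at \<open>x = arcsin_p s\<close>, the exponent that the theorem bounds;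
  at \<open>s = 1\<close> it is the exponent at the end point \<open>\<pi>\<^sub>p / 2\<close>.\<close>
definition log_ratio :: "real \<Rightarrow> real \<Rightarrow> real" where
  "log_ratio p s = ln (arcsin_p p s / s) / arcsin_p p s powr p"

section \<open>A sign criterion\<close>

text \<open>A function that starts at \<open>0\<close> cannot become nonpositive if it increases wherever it is
  nonpositive: at a nonpositive minimum over \<open>{0<..x}\<close> the derivative would be positive, so a point
  slightly to the left would have a smaller value. Only the limit at \<open>0\<close> enters, because the
  functions below are built from quotients by \<open>s\<close>, whose values at \<open>s = 0\<close> are not their limits.\<close>
lemma pos_if_zero_limit_and_increasing_while_nonpos:
  fixes f f' :: "real \<Rightarrow> real"
  assumes lim: "(f \<longlongrightarrow> 0) (at_right 0)"
    and der: "\<And>x. 0 < x \<Longrightarrow> x < b \<Longrightarrow> (f has_real_derivative f' x) (at x)"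
    and pos: "\<And>x. 0 < x \<Longrightarrow> x < b \<Longrightarrow> f x \<le> 0 \<Longrightarrow> f' x > 0"
    and x: "0 < x" "x < b"
  shows "f x > 0"
proof (rule ccontr)
  assume nonpos: "\<not> f x > 0"
  define g where "g y = (if y = 0 then 0 else f y)" for y
  have "continuous_on {0..x} g"
    unfolding continuous_on_eq_continuous_within
  proof
    fix y assume y: "y \<in> {0..x}"
    show "continuous (at y within {0..x}) g"
    proof (cases "y = 0")
      case True
      have "(g \<longlongrightarrow> 0) (at_right 0)"
        using lim by (rule Lim_transform_eventually)
          (auto simp: g_def eventually_at_filter)
      then have "(g \<longlongrightarrow> g 0) (at 0 within {0..x})"
        using x by (simp add: g_def at_within_Icc_at_right)
      then show ?thesis using True by (simp add: continuous_within)
    next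
      case False
      then have y: "0 < y" "y < b" using y x by auto
      have "isCont f y" using der[OF y] by (rule DERIV_isCont)
      moreover have "\<forall>\<^sub>F z in nhds y. f z = g z"
        using t1_space_nhds[OF False] by eventually_elim (simp add: g_def)
      ultimately have "isCont g y" using isCont_cong by blast
      then show ?thesis by (rule continuous_at_imp_continuous_at_within)
    qed
  qed
  then obtain m where m: "m \<in> {0..x}" "\<And>y. y \<in> {0..x} \<Longrightarrow> g m \<le> g y"
    using continuous_attains_inf[of "{0..x}" g] x by auto
  \<comment> \<open>The minimum may be taken away from \<open>0\<close>, since \<open>g x \<le> 0 = g 0\<close>.\<close>
  obtain k where k: "0 < k" "k \<le> x" "\<And>y. y \<in> {0..x} \<Longrightarrow> g k \<le> g y" "f k \<le> 0"
  proof (cases "m = 0")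
    case True
    then have "g x \<le> g y" if "y \<in> {0..x}" for y
      using m(2)[OF that] nonpos x by (auto simp: g_def)
    then show ?thesis using that[of x] x nonpos by auto
  next
    case False
    then have "g m \<le> 0" using m(2)[of 0] x by (auto simp: g_def)
    then show ?thesis using that[of m] m False by (auto simp: g_def)
  qed
  have kb: "k < b" using k x by simp
  obtain d where d: "d > 0" "\<And>h. h > 0 \<Longrightarrow> h < d \<Longrightarrow> f (k - h) < f k"
    using DERIV_pos_inc_left[OF der[OF k(1) kb] pos[OF k(1) kb k(4)]] by blast
  define h where "h = min d k / 2"
  have h: "h > 0" "h < d" "h < k" using d(1) k(1) by (auto simp: h_def min_def)
  have "g k \<le> g (k - h)" using k h by auto
  then show False using d(2)[OF h(1,2)] h k(1) by (auto simp: g_def)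
qed

section \<open>The generalized arcsine and its derivative\<close>
lemma powr_strictly_between_0_1:
  fixes p s :: real
  assumes "p > 1" "0 < s" "s < 1"
  shows "0 < s powr p" "s powr p < 1"
  using assms powr_less_mono2[of p s 1] by auto

lemma cos_of_sin_bounds:
  assumes "p > 1" "0 < s" "s < 1"
  shows "1 - s powr p < cos_of_sin p s" "0 < cos_of_sin p s" "cos_of_sin p s < 1"
proof -
  note t = powr_strictly_between_0_1[OF assms]
  show "0 < cos_of_sin p s" "cos_of_sin p s < 1"
    using t assms powr_less_mono2[of "1/p" "1 - s powr p" 1] by (auto simp: cos_of_sin_def)
  show "1 - s powr p < cos_of_sin p s"
    using t assms powr_less_mono'[of "1 - s powr p" "1/p" 1] by (auto simp: cos_of_sin_def)
qed

text \<open>The derivative of \<open>s\<^sup>p\<close> in a form that keeps \<open>s powr p\<close> as an atom, so that the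
  computations below are rational in \<open>s powr p\<close>.\<close>
lemma powr_has_derivative:
  assumes "0 < (s::real)"
  shows "((\<lambda>s. s powr p) has_real_derivative p * s powr p / s) (at s)"
  using has_real_derivative_powr[OF assms, of p] assms by (simp add: powr_diff)

lemma cos_of_sin_has_derivative:
  assumes "p > 1" "0 < s" "s < 1"
  shows "(cos_of_sin p has_real_derivative
           - (s powr p * cos_of_sin p s / (s * (1 - s powr p)))) (at s)"
proof -
  note t = powr_strictly_between_0_1[OF assms]
  have "((\<lambda>s. 1 - s powr p) has_real_derivative 0 - p * s powr p / s) (at s)"
    using assms by (intro DERIV_diff DERIV_const powr_has_derivative) auto
  then have "((\<lambda>s. (1 - s powr p) powr (1 / p)) has_real_derivative
      1 / p * (1 - s powr p) powr (1 / p) / (1 - s powr p) * (0 - p * s powr p / s)) (at s)"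
    using t by (intro DERIV_chain2[OF powr_has_derivative]) auto
  moreover have "1 / p * (1 - s powr p) powr (1 / p) / (1 - s powr p) * (0 - p * s powr p / s)
      = - (s powr p * (1 - s powr p) powr (1 / p) / (s * (1 - s powr p)))"
    using assms by (simp add: mult.commute)
  ultimately show ?thesis by (simp add: cos_of_sin_def[abs_def])
qed

text \<open>Since \<open>t\<^sup>p \<le> t\<close> on the unit interval, the integrand is dominated by \<open>(1 - t)\<^sup>-\<^sup>1\<^sup>/\<^sup>p\<close>, which has
  a continuous antiderivative because \<open>1 / p < 1\<close>.\<close>
lemma arcsin_p_integrand_integrable:
  assumes "p > 1"
  shows "(\<lambda>t. 1 / (1 - t powr p) powr (1 / p)) integrable_on {0..1::real}"
proof (rule measurable_bounded_by_integrable_imp_integrable)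
  show "(\<lambda>t. 1 / (1 - t powr p) powr (1 / p)) \<in> borel_measurable (lebesgue_on {0..1::real})"
    by (rule borel_measurable_if_D measurable_restrict_space1 measurable_completion)+ simp
  define q where "q = 1 - 1 / p"
  have q: "q > 0" using assms by (simp add: q_def)
  have "((\<lambda>t. 1 / (1 - t) powr (1 / p)) has_integral
           (- ((1 - 1) powr q / q) - (- ((1 - 0) powr q / q)))) {0..1::real}"
  proof (rule fundamental_theorem_of_calculus_interior)
    show "continuous_on {0..1} (\<lambda>x::real. - ((1 - x) powr q / q))"
      using q by (intro continuous_intros continuous_on_powr') auto
    fix x :: real assume "x \<in> {0<..<1}"
    then have x: "0 < 1 - x" by simp
    have "((\<lambda>x. 1 - x) has_real_derivative 0 - 1) (at x)"
      by (intro DERIV_diff DERIV_const DERIV_ident)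
    then have "((\<lambda>x. - ((1 - x) powr q / q)) has_real_derivative
        - (q * (1 - x) powr q / (1 - x) * (0 - 1) / q)) (at x)"
      by (intro DERIV_minus DERIV_cdivide
          DERIV_chain2[where f = "\<lambda>x. x powr q" and g = "\<lambda>x. 1 - x"]
          powr_has_derivative[OF x])
    moreover have "- (q * (1 - x) powr q / (1 - x) * (0 - 1) / q) = 1 / (1 - x) powr (1 / p)"
      using assms x by (simp add: q_def powr_diff)
    ultimately show "((\<lambda>x. - ((1 - x) powr q / q)) has_vector_derivative
        1 / (1 - x) powr (1 / p)) (at x)"
      by (simp add: has_real_derivative_iff_has_vector_derivative)
  qed auto
  then show "(\<lambda>t. 1 / (1 - t) powr (1 / p)) integrable_on {0..1::real}" by blast
  fix t :: real assume t: "t \<in> {0..1}"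
  show "norm (1 / (1 - t powr p) powr (1 / p)) \<le> 1 / (1 - t) powr (1 / p)"
  proof (cases "t = 1")
    case False
    then have t: "0 \<le> t" "t < 1" using t by auto
    have "t powr p \<le> t powr 1" using t assms by (intro powr_mono') auto
    then have "(1 - t) powr (1 / p) \<le> (1 - t powr p) powr (1 / p)"
      using t assms by (intro powr_mono2) auto
    then show ?thesis using t by (auto intro!: divide_left_mono mult_pos_pos)
  qed auto
qed auto

lemma arcsin_p_continuous:
  assumes "p > 1"
  shows "continuous_on {0..1} (arcsin_p p)"
  unfolding arcsin_p_def[abs_def]
  by (rule indefinite_integral_continuous_1[OF arcsin_p_integrand_integrable[OF assms]])

lemma arcsin_p_zero: "arcsin_p p 0 = 0"
  by (simp add: arcsin_p_def)

lemma arcsin_p_has_derivative: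
  assumes "p > 1" "0 < s" "s < 1"
  shows "(arcsin_p p has_real_derivative 1 / cos_of_sin p s) (at s)"
proof -
  define b where "b = (1 + s) / 2"
  have b: "s < b" "b < 1" using assms by (auto simp: b_def)
  \<comment> \<open>Staying left of \<open>b < 1\<close> keeps the integrand continuous.\<close>
  have ne: "t powr p < 1" if "t \<in> {0..b}" for t
    using that b assms powr_less_mono2[of p t 1] by auto
  have "continuous_on {0..b} (\<lambda>t. 1 / (1 - t powr p) powr (1 / p))"
    using ne assms
    by (intro continuous_on_divide continuous_on_powr' continuous_on_diff continuous_on_const
        continuous_on_id) fastforce+
  from integral_has_real_derivative[OF this, of s] show ?thesis
    using b assms at_within_Icc_at[of 0 s b]
    by (simp add: arcsin_p_def[abs_def] cos_of_sin_def)
qed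

lemma arcsin_p_strict_mono:
  assumes "p > 1" "0 \<le> a" "a < b" "b \<le> 1"
  shows "arcsin_p p a < arcsin_p p b"
proof (rule DERIV_pos_imp_increasing_open[OF assms(3)])
  fix x assume "a < x" "x < b"
  then have "0 < x" "x < 1" using assms by auto
  then show "\<exists>y. (arcsin_p p has_real_derivative y) (at x) \<and> 0 < y"
    using arcsin_p_has_derivative[OF assms(1)] cos_of_sin_bounds[OF assms(1)]
    by (meson zero_less_divide_1_iff)
qed (use arcsin_p_continuous[OF assms(1)] assms continuous_on_subset in force)

lemma arcsin_p_tendsto_zero:
  assumes "p > 1"
  shows "(arcsin_p p \<longlongrightarrow> 0) (at_right 0)"
proof -
  have "continuous (at 0 within {0..1}) (arcsin_p p)"
    using arcsin_p_continuous[OF assms] by (auto simp: continuous_on_eq_continuous_within)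
  then show ?thesis
    by (simp add: continuous_within at_within_Icc_at_right arcsin_p_zero)
qed

lemma powr_tendsto_zero:
  assumes "p > 0"
  shows "((\<lambda>s::real. s powr p) \<longlongrightarrow> 0) (at_right 0)"
proof -
  have "((\<lambda>s::real. s powr p) \<longlongrightarrow> 0 powr p) (at_right 0)"
    using assms by (intro tendsto_powr2 tendsto_intros) (auto simp: eventually_at_filter)
  then show ?thesis by simp
qed

lemma cos_of_sin_tendsto_one:
  assumes "p > 1"
  shows "(cos_of_sin p \<longlongrightarrow> 1) (at_right 0)"
proof -
  have "((\<lambda>s. (1 - s powr p) powr (1 / p)) \<longlongrightarrow> (1 - 0) powr (1 / p)) (at_right 0)"
    using assms by (intro tendsto_powr tendsto_diff powr_tendsto_zero tendsto_const) auto
  then show ?thesis by (simp add: cos_of_sin_def[abs_def])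
qed

section \<open>Bounds and differential equation for the defect\<close>

text \<open>The derivative \<open>1 / cos_p\<close> of the arcsine exceeds \<open>1\<close>.\<close>
lemma arcsin_p_gt_self:
  assumes "p > 1" "0 < s" "s < 1"
  shows "s < arcsin_p p s"
proof -
  have "arcsin_p p s - s > 0"
  proof (rule pos_if_zero_limit_and_increasing_while_nonpos[where
        f = "\<lambda>s. arcsin_p p s - s" and b = 1])
    have "((\<lambda>s. arcsin_p p s - s) \<longlongrightarrow> 0 - 0) (at_right 0)"
      by (intro tendsto_diff arcsin_p_tendsto_zero[OF assms(1)] tendsto_ident_at)
    then show "((\<lambda>s. arcsin_p p s - s) \<longlongrightarrow> 0) (at_right 0)" by simp
    fix x :: real assume x: "0 < x" "x < 1"
    show "((\<lambda>s. arcsin_p p s - s) has_real_derivative 1 / cos_of_sin p x - 1) (at x)"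
      by (intro derivative_intros arcsin_p_has_derivative assms x)
    show "1 / cos_of_sin p x - 1 > 0"
      using cos_of_sin_bounds[OF assms(1) x] by (simp add: field_simps)
  qed (use assms in auto)
  then show ?thesis by simp
qed

lemma arcsin_p_cos_gap_has_derivative:
  assumes "p > 1" "0 < s" "s < 1"
  shows "((\<lambda>s. s - arcsin_p p s * cos_of_sin p s) has_real_derivative
           arcsin_p p s * s powr p * cos_of_sin p s / (s * (1 - s powr p))) (at s)"
  using assms cos_of_sin_bounds[OF assms]
  by (auto intro!: derivative_eq_intros arcsin_p_has_derivative cos_of_sin_has_derivative)

lemma arcsin_p_cos_lt_self:
  assumes "p > 1" "0 < s" "s < 1"
  shows "arcsin_p p s * cos_of_sin p s < s"
proof -
  have "s - arcsin_p p s * cos_of_sin p s > 0"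
  proof (rule pos_if_zero_limit_and_increasing_while_nonpos[where
        f = "\<lambda>s. s - arcsin_p p s * cos_of_sin p s" and b = 1])
    have "((\<lambda>s. s - arcsin_p p s * cos_of_sin p s) \<longlongrightarrow> 0 - 0 * 1) (at_right 0)"
      by (intro tendsto_intros arcsin_p_tendsto_zero[OF assms(1)]
          cos_of_sin_tendsto_one[OF assms(1)])
    then show "((\<lambda>s. s - arcsin_p p s * cos_of_sin p s) \<longlongrightarrow> 0) (at_right 0)" by simp
    fix x :: real assume x: "0 < x" "x < 1"
    show "((\<lambda>s. s - arcsin_p p s * cos_of_sin p s) has_real_derivative
           arcsin_p p x * x powr p * cos_of_sin p x / (x * (1 - x powr p))) (at x)"
      by (rule arcsin_p_cos_gap_has_derivative[OF assms(1) x])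
    show "0 < arcsin_p p x * x powr p * cos_of_sin p x / (x * (1 - x powr p))"
      using cos_of_sin_bounds[OF assms(1) x] powr_strictly_between_0_1[OF assms(1) x]
        arcsin_p_gt_self[OF assms(1) x] x
      by (intro divide_pos_pos mult_pos_pos) auto
  qed (use assms in auto)
  then show ?thesis by simp
qed

text \<open>Positivity is \<open>arcsin_p s \<cdot> cos_p < s\<close>; the upper bound \<open>h < t\<close> says \<open>(arcsin_p s / s) cos_p > 1 - t\<close>,
  and here the first factor exceeds \<open>1\<close> while \<open>cos_p > cos_p\<^sup>p = 1 - t\<close>.\<close>
lemma defect_bounds:
  assumes "p > 1" "0 < s" "s < 1"
  shows "0 < defect p s" "defect p s < s powr p"
proof -
  show "0 < defect p s"
    using arcsin_p_cos_lt_self[OF assms] assms by (simp add: defect_def field_simps)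
  have "(1 - s powr p) * s < cos_of_sin p s * s"
    using cos_of_sin_bounds[OF assms] assms by simp
  also have "\<dots> < cos_of_sin p s * arcsin_p p s"
    using cos_of_sin_bounds[OF assms] arcsin_p_gt_self[OF assms] by simp
  finally show "defect p s < s powr p"
    using assms by (simp add: defect_def field_simps)
qed

lemma defect_tendsto_zero:
  assumes "p > 1"
  shows "(defect p \<longlongrightarrow> 0) (at_right 0)"
proof (rule tendsto_sandwich[where f = "\<lambda>_. 0" and h = "\<lambda>s. s powr p"])
  show "((\<lambda>s. s powr p) \<longlongrightarrow> 0) (at_right 0)" using assms by (intro powr_tendsto_zero) auto
  have "\<forall>\<^sub>F s in at_right 0. s \<in> {0<..<1::real}"
    by (rule eventually_at_right_real) simp
  then show "\<forall>\<^sub>F s in at_right 0. 0 \<le> defect p s" "\<forall>\<^sub>F s in at_right 0. defect p s \<le> s powr p"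
    by (eventually_elim, use defect_bounds[OF assms] in \<open>force intro: less_imp_le\<close>)+
qed auto

text \<open>The differential equation \<open>s (1 - t) h' = t - h\<close> with \<open>t = s\<^sup>p\<close>, which replaces the arcsine
  in the barrier argument below.\<close>
lemma defect_has_derivative:
  assumes "p > 1" "0 < s" "s < 1"
  shows "(defect p has_real_derivative
           (s powr p - defect p s) / (s * (1 - s powr p))) (at s)"
  unfolding defect_def[abs_def]
  using assms cos_of_sin_bounds[OF assms] powr_strictly_between_0_1[OF assms]
  by (auto intro!: derivative_eq_intros arcsin_p_has_derivative cos_of_sin_has_derivative
      simp: field_simps)

text \<open>This rule and the next one rest on \<open>arcsin_p s \<cdot> cos_p = s (1 - h)\<close>, that is,
  \<open>s \<cdot> arcsin_p' / arcsin_p = 1 / (1 - h)\<close>.\<close>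
lemma ln_arcsin_p_ratio_has_derivative:
  assumes "p > 1" "0 < s" "s < 1"
  shows "((\<lambda>s. ln (arcsin_p p s / s)) has_real_derivative
           defect p s / (s * (1 - defect p s))) (at s)"
proof -
  note b = cos_of_sin_bounds[OF assms] arcsin_p_gt_self[OF assms]
  have "((\<lambda>s. ln (arcsin_p p s / s)) has_real_derivative
          ((1 / cos_of_sin p s * s - arcsin_p p s * 1) / (s * s)) / (arcsin_p p s / s)) (at s)"
    using b assms
    by (auto intro!: derivative_eq_intros arcsin_p_has_derivative)
  moreover have "((1 / cos_of_sin p s * s - arcsin_p p s * 1) / (s * s)) / (arcsin_p p s / s)
      = defect p s / (s * (1 - defect p s))"
    using b assms by (simp add: defect_def field_simps)
  ultimately show ?thesis by simp
qed

lemma arcsin_p_powr_has_derivative: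
  assumes "p > 1" "0 < s" "s < 1"
  shows "((\<lambda>s. arcsin_p p s powr p) has_real_derivative
           p * arcsin_p p s powr p / (s * (1 - defect p s))) (at s)"
proof -
  note b = cos_of_sin_bounds[OF assms] arcsin_p_gt_self[OF assms]
  have "((\<lambda>s. arcsin_p p s powr p) has_real_derivative
           p * arcsin_p p s powr p / arcsin_p p s * (1 / cos_of_sin p s)) (at s)"
    using b assms
    by (intro DERIV_chain2[OF powr_has_derivative arcsin_p_has_derivative]) auto
  moreover have "s * (1 - defect p s) = arcsin_p p s * cos_of_sin p s"
    using assms by (simp add: defect_def)
  ultimately show ?thesis by simp
qed

section \<open>The barrier inequality\<close>
lemma concave_quadratic_pos:
  fixes a b c u v x :: real
  assumes "a \<ge> 0" "u \<le> x" "x \<le> v"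
    and u: "- a * u\<^sup>2 + b * u + c > 0" and v: "- a * v\<^sup>2 + b * v + c > 0"
  shows "- a * x\<^sup>2 + b * x + c > 0"
proof (cases "u = v")
  case False
  then have uv: "u < v" using assms by simp
  have "(v - u) * (- a * x\<^sup>2 + b * x + c) =
      (v - x) * (- a * u\<^sup>2 + b * u + c) + (x - u) * (- a * v\<^sup>2 + b * v + c)
      + a * ((x - u) * (v - x) * (v - u))"
    by (simp add: power2_eq_square algebra_simps)
  moreover have "(v - x) * (- a * u\<^sup>2 + b * u + c) + (x - u) * (- a * v\<^sup>2 + b * v + c) > 0"
  proof (cases "x = u")
    case True
    then show ?thesis using u uv by simp
  next
    case False
    then have "(x - u) * (- a * v\<^sup>2 + b * v + c) > 0" using v assms by simp
    moreover have "(v - x) * (- a * u\<^sup>2 + b * u + c) \<ge> 0" using u assms by simp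
    ultimately show ?thesis by simp
  qed
  moreover have "a * ((x - u) * (v - x) * (v - u)) \<ge> 0" using assms by simp
  ultimately have "(v - u) * (- a * x\<^sup>2 + b * x + c) > 0" by linarith
  then show ?thesis using uv by (simp add: zero_less_mult_iff)
qed (use assms in auto)

text \<open>With \<open>\<Phi> = t (1 + (p - 1) h) - h (1 + p - h)\<close> and \<open>s (1 - t) h' = t - h\<close>, the left-hand side of the
  conclusion is \<open>s (1 - t) \<Phi>'\<close>; thus \<open>\<Phi>\<close> increases wherever it is nonpositive. For fixed \<open>h\<close> the expression is a
  concave quadratic in \<open>t\<close>, so it suffices to look at the ends of the range of \<open>t\<close>: at \<open>t = h\<close> it is
  \<open>p h (1 - h) (1 + (p - 1) h)\<close>, and at the zero \<open>v\<close> of \<open>\<Phi>\<close> it has the sign of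
  \<open>(p\<^sup>2 - p - 1) - (p - 1) h\<close>. The latter is positive for all \<open>h < 1\<close> exactly when \<open>p (p - 2) \<ge> 0\<close>,
  which is where \<open>p \<ge> 2\<close> comes from.\<close>
lemma barrier_direction:
  fixes p t h :: real
  assumes p: "p \<ge> 2" and h: "0 < h" "h < 1" "h < t"
    and below: "t * (1 + (p - 1) * h) \<le> h * (1 + p - h)"
  shows "p * t * (1 - t) * (1 + (p - 1) * h) + (t - h) * ((p - 1) * t - (1 + p - 2 * h)) > 0"
proof -
  define D where "D = 1 + (p - 1) * h"
  define v where "v = h * (1 + p - h) / D"
  define a where "a = p * D - (p - 1)"
  define b where "b = p * D - (p - 1) * h - (1 + p - 2 * h)"
  define c where "c = h * (1 + p - 2 * h)"
  have E: "p * x * (1 - x) * D + (x - h) * ((p - 1) * x - (1 + p - 2 * h))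
      = - a * x\<^sup>2 + b * x + c" for x
    unfolding a_def b_def c_def by (simp add: power2_eq_square algebra_simps)
  have D: "D > 0" using p h by (simp add: D_def add_pos_nonneg)
  have Dv: "D * v = h * (1 + p - h)" using D by (simp add: v_def)
  have "a = 1 + p * (p - 1) * h" by (simp add: a_def D_def algebra_simps)
  then have a: "a \<ge> 0" using p h by simp
  have tv: "t \<le> v" using below D by (simp add: v_def D_def field_simps)
  have "- a * t\<^sup>2 + b * t + c > 0"
  proof (rule concave_quadratic_pos[OF a _ tv])
    show "h \<le> t" using h by simp
    have "0 < p * h * (1 - h) * D" using p h D by simp
    then show "- a * h\<^sup>2 + b * h + c > 0" using E[of h] by simp
    \<comment> \<open>Multiplying by \<open>D\<^sup>2\<close> leaves \<open>v\<close> only in the combination \<open>D v\<close>, a polynomial in \<open>h\<close>.\<close>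
    have "D\<^sup>2 * (p * v * (1 - v) * D + (v - h) * ((p - 1) * v - (1 + p - 2 * h)))
        = D * (p * (D * v) * (D - D * v)) + (D * v - D * h) * ((p - 1) * (D * v) - D * (1 + p - 2 * h))"
      by (simp add: power2_eq_square algebra_simps)
    also have "\<dots> = p * h\<^sup>2 * (1 - h)\<^sup>2 * ((p\<^sup>2 - p - 1) - (p - 1) * h)"
      unfolding Dv unfolding D_def by (simp add: power2_eq_square algebra_simps)
    also have "\<dots> > 0"
    proof -
      have "(p - 1) * h < (p - 1) * 1" using p h by (intro mult_strict_left_mono) auto
      moreover have "p * (p - 2) \<ge> 0" using p by simp
      ultimately have "(p\<^sup>2 - p - 1) - (p - 1) * h > 0"
        by (simp add: power2_eq_square algebra_simps)
      then show ?thesis using p h by simp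
    qed
    finally show "- a * v\<^sup>2 + b * v + c > 0"
      using D unfolding E by (simp add: zero_less_mult_iff)
  qed
  then show ?thesis using E[of t] by (simp add: D_def)
qed

text \<open>The inequality \<open>\<Phi> > 0\<close>, in which the arcsine occurs only through \<open>h\<close>. Both \<open>t\<close> and \<open>h\<close> vanish
  at \<open>0\<close>, so the sign criterion applies.\<close>
lemma defect_below_barrier:
  assumes p: "p \<ge> 2" and s: "0 < s" "s < 1"
  shows "defect p s * (1 + p - defect p s) < s powr p * (1 + (p - 1) * defect p s)"
proof -
  have p1: "p > 1" using p by simp
  let ?f = "\<lambda>s. s powr p * (1 + (p - 1) * defect p s) - defect p s * (1 + p - defect p s)"
  let ?E = "\<lambda>s. p * s powr p * (1 - s powr p) * (1 + (p - 1) * defect p s)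
      + (s powr p - defect p s) * ((p - 1) * s powr p - (1 + p - 2 * defect p s))"
  have "?f s > 0"
  proof (rule pos_if_zero_limit_and_increasing_while_nonpos[where f = ?f and b = 1
        and f' = "\<lambda>s. ?E s / (s * (1 - s powr p))"])
    have "(?f \<longlongrightarrow> 0 * (1 + (p - 1) * 0) - 0 * (1 + p - 0)) (at_right 0)"
      by (intro tendsto_intros defect_tendsto_zero powr_tendsto_zero) (use p in auto)
    then show "(?f \<longlongrightarrow> 0) (at_right 0)" by simp
    fix x :: real assume x: "0 < x" "x < 1"
    note t = powr_strictly_between_0_1[OF p1 x]
    define h' where "h' = (x powr p - defect p x) / (x * (1 - x powr p))"
    have h': "(defect p has_real_derivative h') (at x)"
      using defect_has_derivative[OF p1 x] by (simp add: h'_def)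
    have "(?f has_real_derivative
        p * x powr p / x * (1 + (p - 1) * defect p x) + (p - 1) * h' * x powr p
        - (h' * (1 + p - defect p x) - h' * defect p x)) (at x)"
      using x by (auto intro!: derivative_eq_intros h' simp: powr_diff)
    moreover have "p * x powr p / x * (1 + (p - 1) * defect p x) + (p - 1) * h' * x powr p
        - (h' * (1 + p - defect p x) - h' * defect p x) = ?E x / (x * (1 - x powr p))"
    proof -
      \<comment> \<open>Over the common denominator \<open>x (1 - x\<^sup>p)\<close> of \<open>h'\<close> the identity is polynomial.\<close>
      have slope: "p * x powr p / x = p * x powr p * (1 - x powr p) / (x * (1 - x powr p))"
        and nz: "x * (1 - x powr p) \<noteq> 0"
        using x t by auto
      have common: "p * t * (1 - t) / z * (1 + (p - 1) * d) + (p - 1) * ((t - d) / z) * t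
          - ((t - d) / z * (1 + p - d) - (t - d) / z * d)
        = (p * t * (1 - t) * (1 + (p - 1) * d) + (t - d) * ((p - 1) * t - (1 + p - 2 * d))) / z"
        if "z \<noteq> 0" for t d z
        using that by (simp add: divide_simps) (simp add: algebra_simps)
      show ?thesis unfolding h'_def slope by (rule common[OF nz])
    qed
    ultimately show "(?f has_real_derivative ?E x / (x * (1 - x powr p))) (at x)" by simp
    assume "?f x \<le> 0"
    then have "?E x > 0"
      using defect_bounds[OF p1 x] t by (intro barrier_direction[OF p]) auto
    then show "?E x / (x * (1 - x powr p)) > 0" using x t by simp
  qed (use s in auto)
  then show ?thesis by simp
qed

section \<open>Monotonicity and limits of the exponent\<close>
lemma arcsin_p_ratio_tendsto_one:
  assumes "p > 1"
  shows "((\<lambda>s. arcsin_p p s / s) \<longlongrightarrow> 1) (at_right 0)"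
proof (rule tendsto_sandwich[where f = "\<lambda>_. 1" and h = "\<lambda>s. 1 / cos_of_sin p s"])
  have "((\<lambda>s. 1 / cos_of_sin p s) \<longlongrightarrow> 1 / 1) (at_right 0)"
    by (intro tendsto_intros cos_of_sin_tendsto_one assms) auto
  then show "((\<lambda>s. 1 / cos_of_sin p s) \<longlongrightarrow> 1) (at_right 0)" by simp
  have ev: "\<forall>\<^sub>F s in at_right 0. s \<in> {0<..<1::real}"
    by (rule eventually_at_right_real) simp
  show "\<forall>\<^sub>F s in at_right 0. 1 \<le> arcsin_p p s / s"
    using ev by eventually_elim (use arcsin_p_gt_self[OF assms] in \<open>auto intro: less_imp_le\<close>)
  show "\<forall>\<^sub>F s in at_right 0. arcsin_p p s / s \<le> 1 / cos_of_sin p s"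
    using ev
  proof eventually_elim
    case (elim s)
    then have s: "0 < s" "s < 1" by auto
    show ?case
      using arcsin_p_cos_lt_self[OF assms s] cos_of_sin_bounds[OF assms s] s
      by (simp add: field_simps)
  qed
qed auto

text \<open>The difference \<open>h - p ln (arcsin_p s / s)\<close> starts at \<open>0\<close>, and its derivative is
  \<open>\<Phi> / (s (1 - t) (1 - h))\<close>.\<close>
lemma defect_gt_ln_arcsin_p_ratio:
  assumes p: "p \<ge> 2" and s: "0 < s" "s < 1"
  shows "p * ln (arcsin_p p s / s) < defect p s"
proof -
  have p1: "p > 1" using p by simp
  let ?f = "\<lambda>s. defect p s - p * ln (arcsin_p p s / s)"
  let ?f' = "\<lambda>s. (s powr p - defect p s) / (s * (1 - s powr p))
      - p * (defect p s / (s * (1 - defect p s)))"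
  have "?f s > 0"
  proof (rule pos_if_zero_limit_and_increasing_while_nonpos[where f = ?f and b = 1 and f' = ?f'])
    have "(?f \<longlongrightarrow> 0 - p * ln 1) (at_right 0)"
      by (intro tendsto_intros defect_tendsto_zero arcsin_p_ratio_tendsto_one) (use p in auto)
    then show "(?f \<longlongrightarrow> 0) (at_right 0)" by simp
    fix x :: real assume x: "0 < x" "x < 1"
    note t = powr_strictly_between_0_1[OF p1 x] and h = defect_bounds[OF p1 x]
    show "(?f has_real_derivative ?f' x) (at x)"
      by (intro DERIV_diff DERIV_cmult defect_has_derivative
          ln_arcsin_p_ratio_has_derivative x p1)
    have "?f' x = (x powr p * (1 + (p - 1) * defect p x) - defect p x * (1 + p - defect p x))
        / (x * (1 - x powr p) * (1 - defect p x))"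
      using x t h by (simp add: divide_simps) (simp add: algebra_simps)
    also have "\<dots> > 0"
      using defect_below_barrier[OF p x] x t h by simp
    finally show "?f' x > 0" .
  qed (use s in auto)
  then show ?thesis by simp
qed

text \<open>The derivative of the exponent is a positive multiple of \<open>h - p ln (arcsin_p s / s)\<close>. The end
  point \<open>b = 1\<close>, where the derivative of the arcsine blows up, is reached by continuity.\<close>
lemma log_ratio_strict_mono:
  assumes p: "p \<ge> 2" and s: "0 < a" "a < b" "b \<le> 1"
  shows "log_ratio p a < log_ratio p b"
proof (rule DERIV_pos_imp_increasing_open[OF s(2)])
  have p1: "p > 1" using p by simp
  fix s assume "a < s" "s < b"
  then have s: "0 < s" "s < 1" using s by auto
  define Y where "Y = arcsin_p p s powr p"
  define l where "l = ln (arcsin_p p s / s)"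
  have A: "arcsin_p p s > 0" using arcsin_p_gt_self[OF p1 s] s by simp
  then have Y: "Y > 0" by (simp add: Y_def)
  have h: "defect p s < 1"
    using defect_bounds[OF p1 s] powr_strictly_between_0_1[OF p1 s] by simp
  have "(log_ratio p has_real_derivative
      (defect p s / (s * (1 - defect p s)) * Y - l * (p * Y / (s * (1 - defect p s)))) / (Y * Y)) (at s)"
    unfolding log_ratio_def[abs_def] Y_def l_def using A
    by (intro DERIV_divide ln_arcsin_p_ratio_has_derivative arcsin_p_powr_has_derivative s p1) auto
  moreover have "(defect p s / (s * (1 - defect p s)) * Y - l * (p * Y / (s * (1 - defect p s)))) / (Y * Y)
      = (defect p s - p * l) / (s * (1 - defect p s) * Y)"
  proof -
    have "(d / z * Y - l * (p * Y / z)) / (Y * Y) = (d - p * l) / (z * Y)" if "z \<noteq> 0" for d z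
      using Y that by (simp add: field_simps)
    then show ?thesis using s h by simp
  qed
  moreover have "\<dots> > 0"
    using Y s h defect_gt_ln_arcsin_p_ratio[OF p s] by (simp add: l_def)
  ultimately show "\<exists>y. (log_ratio p has_real_derivative y) (at s) \<and> 0 < y" by metis
next
  have p1: "p > 1" using p by simp
  have "arcsin_p p s > 0" if "s \<in> {a..b}" for s
    using arcsin_p_strict_mono[OF p1, of 0 s] that s by (auto simp: arcsin_p_zero)
  moreover have "continuous_on {a..b} (arcsin_p p)"
    using arcsin_p_continuous[OF p1] by (rule continuous_on_subset) (use s in auto)
  ultimately show "continuous_on {a..b} (log_ratio p)"
    unfolding log_ratio_def[abs_def] using s
    by (intro continuous_on_divide continuous_on_ln continuous_on_powr' continuous_on_const
        continuous_on_id) fastforce+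
qed

text \<open>Two applications of l'Hospital's rule. The quotient of derivatives for \<open>log_ratio\<close> is
  \<open>h / (p arcsin_p\<^sup>p)\<close>, whose numerator is \<open>(s - arcsin_p s \<cdot> cos_p) / s\<close>; the second application shows
  \<open>h \<sim> s\<^sup>p / (p + 1)\<close>, and \<open>arcsin_p s \<sim> s\<close>.\<close>
lemma log_ratio_tendsto:
  assumes p: "p > 1"
  shows "(log_ratio p \<longlongrightarrow> 1 / (p * (p + 1))) (at_right 0)"
proof -
  let ?A = "arcsin_p p"
  have ev: "\<forall>\<^sub>F s in at_right 0. s \<in> {0<..<1::real}"
    by (rule eventually_at_right_real) simp
  have gap: "((\<lambda>s. (s - ?A s * cos_of_sin p s) / s powr (p + 1)) \<longlongrightarrow> 1 / (p + 1)) (at_right 0)"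
  proof (rule lhopital_right_0)
    have "((\<lambda>s. s - ?A s * cos_of_sin p s) \<longlongrightarrow> 0 - 0 * 1) (at_right 0)"
      by (intro tendsto_intros arcsin_p_tendsto_zero cos_of_sin_tendsto_one p)
    then show "((\<lambda>s. s - ?A s * cos_of_sin p s) \<longlongrightarrow> 0) (at_right 0)" by simp
    show "((\<lambda>s::real. s powr (p + 1)) \<longlongrightarrow> 0) (at_right 0)"
      using p by (intro powr_tendsto_zero) auto
    show "\<forall>\<^sub>F s in at_right 0. s powr (p + 1) \<noteq> (0::real)"
      using ev by eventually_elim auto
    show "\<forall>\<^sub>F s in at_right 0. (p + 1) * s powr (p + 1) / s \<noteq> 0"
      using ev by eventually_elim (use p in auto)
    show "\<forall>\<^sub>F s in at_right 0. ((\<lambda>s. s powr (p + 1)) has_real_derivative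
        (p + 1) * s powr (p + 1) / s) (at s)"
      using ev by eventually_elim (rule powr_has_derivative, simp)
    show "\<forall>\<^sub>F s in at_right 0. ((\<lambda>s. s - ?A s * cos_of_sin p s) has_real_derivative
        ?A s * s powr p * cos_of_sin p s / (s * (1 - s powr p))) (at s)"
      using ev by eventually_elim (rule arcsin_p_cos_gap_has_derivative[OF p], auto)
    have "((\<lambda>s. ?A s / s * cos_of_sin p s / ((1 - s powr p) * (p + 1)))
        \<longlongrightarrow> 1 * 1 / ((1 - 0) * (p + 1))) (at_right 0)"
      by (intro tendsto_intros arcsin_p_ratio_tendsto_one cos_of_sin_tendsto_one
          powr_tendsto_zero) (use p in auto)
    then have "((\<lambda>s. ?A s / s * cos_of_sin p s / ((1 - s powr p) * (p + 1)))
        \<longlongrightarrow> 1 / (p + 1)) (at_right 0)" by simp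
    then show "((\<lambda>s. ?A s * s powr p * cos_of_sin p s / (s * (1 - s powr p))
        / ((p + 1) * s powr (p + 1) / s)) \<longlongrightarrow> 1 / (p + 1)) (at_right 0)"
    proof (rule Lim_transform_eventually)
      show "\<forall>\<^sub>F s in at_right 0. ?A s / s * cos_of_sin p s / ((1 - s powr p) * (p + 1))
          = ?A s * s powr p * cos_of_sin p s / (s * (1 - s powr p)) / ((p + 1) * s powr (p + 1) / s)"
        using ev by eventually_elim (simp add: powr_add)
    qed
  qed
  have "((\<lambda>s. (s - ?A s * cos_of_sin p s) / s powr (p + 1) / (?A s / s) powr p / p)
      \<longlongrightarrow> 1 / (p + 1) / 1 powr p / p) (at_right 0)"
    by (intro tendsto_intros gap arcsin_p_ratio_tendsto_one) (use p in auto)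
  then have lim: "((\<lambda>s. (s - ?A s * cos_of_sin p s) / s powr (p + 1) / (?A s / s) powr p / p)
      \<longlongrightarrow> 1 / (p * (p + 1))) (at_right 0)"
    by (simp add: mult.commute)
  show ?thesis
    unfolding log_ratio_def[abs_def]
  proof (rule lhopital_right_0)
    have "((\<lambda>s. ln (?A s / s)) \<longlongrightarrow> ln 1) (at_right 0)"
      by (intro tendsto_intros arcsin_p_ratio_tendsto_one p) auto
    then show "((\<lambda>s. ln (?A s / s)) \<longlongrightarrow> 0) (at_right 0)" by simp
    have A: "?A s > 0" if "0 < s" "s < 1" for s
      using arcsin_p_gt_self[OF p that] that by simp
    have h: "defect p s < 1" if "0 < s" "s < 1" for s
      using defect_bounds[OF p that] powr_strictly_between_0_1[OF p that] by simp
    have "((\<lambda>s. ?A s powr p) \<longlongrightarrow> 0 powr p) (at_right 0)"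
    proof (rule tendsto_powr2)
      show "\<forall>\<^sub>F s in at_right 0. 0 \<le> ?A s"
        using ev by eventually_elim (use A in \<open>auto intro: less_imp_le\<close>)
    qed (use p in \<open>auto intro: arcsin_p_tendsto_zero\<close>)
    then show "((\<lambda>s. ?A s powr p) \<longlongrightarrow> 0) (at_right 0)" by simp
    show "\<forall>\<^sub>F s in at_right 0. ?A s powr p \<noteq> 0"
      using ev by eventually_elim (use A in force)
    show "\<forall>\<^sub>F s in at_right 0. p * ?A s powr p / (s * (1 - defect p s)) \<noteq> 0"
      using ev by eventually_elim (use A h p in force)
    show "\<forall>\<^sub>F s in at_right 0. ((\<lambda>s. ln (?A s / s)) has_real_derivative
        defect p s / (s * (1 - defect p s))) (at s)"
      using ev by eventually_elim (rule ln_arcsin_p_ratio_has_derivative[OF p], auto)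
    show "\<forall>\<^sub>F s in at_right 0. ((\<lambda>s. ?A s powr p) has_real_derivative
        p * ?A s powr p / (s * (1 - defect p s))) (at s)"
      using ev by eventually_elim (rule arcsin_p_powr_has_derivative[OF p], auto)
    show "((\<lambda>s. defect p s / (s * (1 - defect p s)) / (p * ?A s powr p / (s * (1 - defect p s))))
        \<longlongrightarrow> 1 / (p * (p + 1))) (at_right 0)"
      using lim
    proof (rule Lim_transform_eventually)
      show "\<forall>\<^sub>F s in at_right 0.
          (s - ?A s * cos_of_sin p s) / s powr (p + 1) / (?A s / s) powr p / p
          = defect p s / (s * (1 - defect p s)) / (p * ?A s powr p / (s * (1 - defect p s)))"
        using ev
      proof eventually_elim
        case (elim s)
        then have s: "0 < s" "s < 1" by auto
        have "d / z / (Y / z) = d / Y" if "z \<noteq> 0" for d z Y :: real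
          using that by simp
        moreover have "s * (1 - defect p s) \<noteq> 0" using s h[OF s] by simp
        ultimately have "defect p s / (s * (1 - defect p s)) / (p * ?A s powr p / (s * (1 - defect p s)))
            = defect p s / (p * ?A s powr p)" by blast
        also have "\<dots> = (s - ?A s * cos_of_sin p s) / s / (p * ?A s powr p)"
          using s by (simp add: defect_def diff_divide_distrib)
        also have "\<dots> = (s - ?A s * cos_of_sin p s) / s powr (p + 1) / (?A s / s) powr p / p"
          using s A[OF s] by (simp add: powr_add powr_divide)
        finally show ?case by (rule sym)
      qed
    qed
  qed
qed

text \<open>Going through \<open>s / 2\<close> makes the inequality strict.\<close>
lemma log_ratio_gt_limit:
  assumes p: "p \<ge> 2" and s: "0 < s" "s < 1"
  shows "1 / (p * (p + 1)) < log_ratio p s"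
proof -
  have "1 / (p * (p + 1)) \<le> log_ratio p (s / 2)"
  proof (rule tendsto_upperbound)
    show "(log_ratio p \<longlongrightarrow> 1 / (p * (p + 1))) (at_right 0)"
      using p by (intro log_ratio_tendsto) simp
    have "\<forall>\<^sub>F r in at_right 0. r \<in> {0<..<s / 2}"
      using s by (intro eventually_at_right_real) simp
    then show "\<forall>\<^sub>F r in at_right 0. log_ratio p r \<le> log_ratio p (s / 2)"
      by eventually_elim (use log_ratio_strict_mono[OF p] s in \<open>force intro: less_imp_le\<close>)
  qed simp
  also have "\<dots> < log_ratio p s" using s by (intro log_ratio_strict_mono[OF p]) auto
  finally show ?thesis .
qed

section \<open>Translation to the generalized sine\<close>
lemma sin_p_arcsin_p:
  assumes "p > 1" "0 \<le> s" "s \<le> 1"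
  shows "sin_p p (arcsin_p p s) = s"
proof -
  have "inj_on (arcsin_p p) {0..1}"
    by (intro strict_mono_on_imp_inj_on strict_mono_onI arcsin_p_strict_mono assms) auto
  then show ?thesis using assms by (simp add: sin_p_def inv_into_f_f)
qed

lemma sin_p_domain_eq_arcsin_p_image:
  assumes "p > 1"
  shows "{0<..<pi_p p / 2} = arcsin_p p ` {0<..<1}"
proof
  show "arcsin_p p ` {0<..<1} \<subseteq> {0<..<pi_p p / 2}"
    using arcsin_p_strict_mono[OF assms, of 0] arcsin_p_strict_mono[OF assms, of _ 1]
    by (auto simp: arcsin_p_zero pi_p_def)
  show "{0<..<pi_p p / 2} \<subseteq> arcsin_p p ` {0<..<1}"
  proof
    fix x assume x: "x \<in> {0<..<pi_p p / 2}"
    then obtain s where "0 \<le> s" "s \<le> 1" "arcsin_p p s = x"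
      using IVT'[of "arcsin_p p" 0 x 1] arcsin_p_continuous[OF assms]
      by (auto simp: arcsin_p_zero pi_p_def)
    moreover from this x have "s \<noteq> 0" "s \<noteq> 1" by (auto simp: arcsin_p_zero pi_p_def)
    ultimately show "x \<in> arcsin_p p ` {0<..<1}" by force
  qed
qed

text \<open>At \<open>x = arcsin_p s\<close> the quotient \<open>sin_p x / x\<close> is \<open>exp (- log_ratio p s \<cdot> x\<^sup>p)\<close>, so an exponential
  bound with constant \<open>k\<close> is a bound on \<open>log_ratio\<close> by \<open>- k\<close>.\<close>
lemma exp_compare_arcsin_p:
  assumes "p > 1" "0 < s" "s < 1"
  shows "exp (k * arcsin_p p s powr p) < s / arcsin_p p s \<longleftrightarrow> log_ratio p s < - k"
    and "s / arcsin_p p s < exp (k * arcsin_p p s powr p) \<longleftrightarrow> - k < log_ratio p s"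
proof -
  have A: "arcsin_p p s > 0" using arcsin_p_gt_self[OF assms] assms by simp
  then have Y: "arcsin_p p s powr p > 0" by simp
  have "s / arcsin_p p s = exp (- (log_ratio p s * arcsin_p p s powr p))"
    using A assms by (simp add: log_ratio_def exp_minus)
  then show "exp (k * arcsin_p p s powr p) < s / arcsin_p p s \<longleftrightarrow> log_ratio p s < - k"
    "s / arcsin_p p s < exp (k * arcsin_p p s powr p) \<longleftrightarrow> - k < log_ratio p s"
    using Y mult_less_cancel_right_pos[OF Y, of k "- log_ratio p s"]
      mult_less_cancel_right_pos[OF Y, of "- log_ratio p s" k] by auto
qed

lemma log_ratio_one:
  assumes "p > 1"
  shows "log_ratio p 1 = - (2 powr p * ln (2 / pi_p p) / pi_p p powr p)"
proof -
  have "pi_p p > 0"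
    using arcsin_p_strict_mono[OF assms, of 0 1] by (simp add: pi_p_def arcsin_p_zero)
  then have A: "arcsin_p p 1 > 0" by (simp add: pi_p_def)
  have "ln (2 / pi_p p) = - ln (arcsin_p p 1)"
    using A by (simp add: pi_p_def ln_div)
  moreover have "pi_p p powr p = 2 powr p * arcsin_p p 1 powr p"
    using A by (simp add: pi_p_def powr_mult)
  ultimately show ?thesis by (simp add: log_ratio_def)
qed

lemma log_ratio_tendsto_one:
  assumes p: "p > 1"
  shows "(log_ratio p \<longlongrightarrow> log_ratio p 1) (at_left 1)"
proof -
  have pos: "arcsin_p p 1 > 0"
    using arcsin_p_strict_mono[OF p, of 0 1] by (simp add: arcsin_p_zero)
  have "continuous (at 1 within {0..1}) (arcsin_p p)"
    using arcsin_p_continuous[OF p] by (auto simp: continuous_on_eq_continuous_within)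
  then have "(arcsin_p p \<longlongrightarrow> arcsin_p p 1) (at_left 1)"
    by (simp add: continuous_within at_within_Icc_at_left)
  then show ?thesis
    unfolding log_ratio_def[abs_def] using pos by (intro tendsto_intros) auto
qed

text \<open>The exponent runs strictly upwards from its limit \<open>- \<beta>\<close> at \<open>s = 0\<close> to its value \<open>- \<alpha>\<close> at
  \<open>s = 1\<close>. This gives the strict bounds, and a constant that works for all \<open>x\<close> satisfies a
  non-strict bound in the limit, so neither constant can be improved.\<close>
theorem theorem3p1:
  fixes p \<alpha> \<beta> :: real
  assumes "p \<ge> 2"
    and "\<alpha> = 2 powr p * ln (2 / pi_p p) / pi_p p powr p"
    and "\<beta> = - (1 / (p * (p + 1)))"
  shows "(\<forall>x\<in>{0<..<pi_p p / 2}.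
            exp (\<alpha> * x powr p) < sin_p p x / x \<and> sin_p p x / x < exp (\<beta> * x powr p))
       \<and> (\<forall>a>\<alpha>. \<not> (\<forall>x\<in>{0<..<pi_p p / 2}. exp (a * x powr p) < sin_p p x / x))
       \<and> (\<forall>b<\<beta>. \<not> (\<forall>x\<in>{0<..<pi_p p / 2}. sin_p p x / x < exp (b * x powr p)))"
proof -
  have p1: "p > 1" using assms(1) by simp
  have lower: "(\<forall>x\<in>{0<..<pi_p p / 2}. exp (k * x powr p) < sin_p p x / x)
      \<longleftrightarrow> (\<forall>s\<in>{0<..<1}. log_ratio p s < - k)" for k
    unfolding sin_p_domain_eq_arcsin_p_image[OF p1] ball_simps
    by (intro ball_cong refl) (simp add: sin_p_arcsin_p[OF p1] exp_compare_arcsin_p(1)[OF p1])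
  have upper: "(\<forall>x\<in>{0<..<pi_p p / 2}. sin_p p x / x < exp (k * x powr p))
      \<longleftrightarrow> (\<forall>s\<in>{0<..<1}. - k < log_ratio p s)" for k
    unfolding sin_p_domain_eq_arcsin_p_image[OF p1] ball_simps
    by (intro ball_cong refl) (simp add: sin_p_arcsin_p[OF p1] exp_compare_arcsin_p(2)[OF p1])
  have \<alpha>: "- \<alpha> = log_ratio p 1" using log_ratio_one[OF p1] assms(2) by simp
  have "\<forall>s\<in>{0<..<1}. log_ratio p s < - \<alpha>"
    using log_ratio_strict_mono[OF assms(1)] by (simp add: \<alpha>)
  moreover have "\<forall>s\<in>{0<..<1}. - \<beta> < log_ratio p s"
    using log_ratio_gt_limit[OF assms(1)] by (simp add: assms(3))
  moreover have "\<not> (\<forall>s\<in>{0<..<1}. log_ratio p s < - a)" if "a > \<alpha>" for a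
  proof
    assume a: "\<forall>s\<in>{0<..<1}. log_ratio p s < - a"
    have ev: "\<forall>\<^sub>F s in at_left 1. s \<in> {0<..<1::real}"
      by (rule eventually_at_left_real) simp
    have "\<forall>\<^sub>F s in at_left 1. log_ratio p s \<le> - a"
      using ev by eventually_elim (use a in \<open>auto intro: less_imp_le\<close>)
    then have "log_ratio p 1 \<le> - a"
      using log_ratio_tendsto_one[OF p1] by (intro tendsto_upperbound) auto
    then show False using that by (simp add: \<alpha>[symmetric])
  qed
  moreover have "\<not> (\<forall>s\<in>{0<..<1}. - b < log_ratio p s)" if "b < \<beta>" for b
  proof
    assume b: "\<forall>s\<in>{0<..<1}. - b < log_ratio p s"
    have ev: "\<forall>\<^sub>F s in at_right 0. s \<in> {0<..<1::real}"
      by (rule eventually_at_right_real) simp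
    have "\<forall>\<^sub>F s in at_right 0. - b \<le> log_ratio p s"
      using ev by eventually_elim (use b in \<open>auto intro: less_imp_le\<close>)
    then have "- b \<le> 1 / (p * (p + 1))"
      using log_ratio_tendsto[OF p1] by (intro tendsto_lowerbound) auto
    then show False using that by (simp add: assms(3))
  qed
  ultimately show ?thesis
    unfolding lower upper ball_conj_distrib by blast
qed

end
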